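(* Let $1 \leq k<d$ be integers, and let $\mu$ and $\nu$ be finite (non-zero) Borel measures on $\mathbb{R}^k$ and $\mathbb{R}^{d-k}$, respectively. Then \[ \dim^\theta_{\mathrm{F}} (\mu \times \nu) \geq \min\Big\{ k\theta +\dim^\theta_{\mathrm{F}} \nu , \ \dim^\theta_{\mathrm{F}} \mu + (d-k)\theta, \ \dim^\theta_{\mathrm{F}} \mu + \dim^\theta_{\mathrm{F}} \nu\Big\} \] and \[ \dim^\theta_{\mathrm{F}} (\mu \times \nu) \leq \min\Big\{ k\theta +\dim^\theta_{\mathrm{F}} \nu , \ \dim^\theta_{\mathrm{F}} \mu + (d-k)\theta \Big\} \] for all $\theta \in [0,1]$. In particular, $\dim_{\mathrm{F}} (\mu \times \nu) = \min \{ \dim_{\mathrm{F}} \mu , \dim_{\mathrm{F}} \nu \}$.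
   Context: All finite Borel measures are assumed to be non-zero. For a finite Borel measure $m$ on $\mathbb{R}^n$, the Fourier transform is $\widehat m(z) = \int e^{-2\pi i z\cdot x}\, dm(x)$ for $z \in \mathbb{R}^n$. For $s \geq 0$ and $\theta\in(0,1]$ define \[ \mathcal{J}_{s,\theta}(m) = \left( \int_{\mathbb{R}^n} |\widehat m(z)|^{2/\theta} |z|^{s/\theta-n} \, dz \right)^{\theta}, \] and $\mathcal{J}_{s,0}(m) = \sup_{z \in \mathbb{R}^n} |\widehat m(z)|^{2} |z|^{s}$. The Fourier spectrum of $m$ at $\theta\in[0,1]$ is \[ \dim^\theta_{\mathrm{F}} m = \sup\{s \geq 0 : \mathcal{J}_{s,\theta}(m) < \infty\} \in [0,\infty], \] with $\sup \emptyset = 0$. The Fourier dimension of $m$ is $\dim_{\mathrm{F}} m = \dim^0_{\mathrm{F}} m = \sup\{s\geq 0: \exists\, c>0,\ |\widehat m(z)| \leq c|z|^{-s/2} \text{ for all } z\ne 0\}$. The measure $\mu\times\nu$ on $\mathbb{R}^d=\mathbb{R}^k\times\mathbb{R}^{d-k}$ is the product measure; in each case the Fourier spectrum is taken with respect to the ambient space ($\mathbb{R}^k$, $\mathbb{R}^{d-k}$ or $\mathbb{R}^d$) on which the measure is defined. *)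

theory Defs
  imports "HOL-Analysis.Analysis"
begin

text \<open>
  The ambient space \<open>\<real>\<^sup>n\<close> is an arbitrary Euclidean space \<open>'a\<close> with \<open>n = DIM('a)\<close>; this covers
  \<^typ>\<open>real ^ 'k\<close> as well as the product \<^typ>\<open>(real ^ 'k) \<times> (real ^ 'l)\<close>, whose norm, inner
  product and Lebesgue measure are those of \<open>\<real>\<^sup>k\<^sup>+\<^sup>l\<close>.
\<close>

definition nonzero_finite_borel_measure :: "'a::euclidean_space measure \<Rightarrow> bool" where
  "nonzero_finite_borel_measure m \<longleftrightarrow>
     sets m = sets borel \<and> finite_measure m \<and> emeasure m UNIV \<noteq> 0"

definition fourier_transform :: "'a::euclidean_space measure \<Rightarrow> 'a \<Rightarrow> complex" where
  "fourier_transform m z =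
     (LINT x|m. exp (- 2 * complex_of_real pi * \<i> * complex_of_real (z \<bullet> x)))"

text \<open>
  The power \<open>x\<^sup>t\<close> for \<open>x \<in> [0, \<infinity>]\<close> and \<open>t > 0\<close>.
\<close>
definition ennreal_power :: "ennreal \<Rightarrow> real \<Rightarrow> ennreal" where
  "ennreal_power x t = (if x = \<infinity> then \<infinity> else ennreal (enn2real x powr t))"

text \<open>
  Since \<open>0 powr t = 0\<close> for every \<open>t\<close>, the integrand vanishes at \<open>z = 0\<close>, a null set.  In the
  supremum the point \<open>z = 0\<close> matters only for \<open>s = 0\<close>, where the convention \<open>0\<^sup>0 = 1\<close> would
  give the same value because the Fourier transform of a finite measure is continuous.
\<close>
definition energy :: "real \<Rightarrow> real \<Rightarrow> 'a::euclidean_space measure \<Rightarrow> ennreal" where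
  "energy s \<theta> m =
     (if \<theta> = 0
      then (SUP z. ennreal ((cmod (fourier_transform m z))\<^sup>2 * norm z powr s))
      else ennreal_power
             (\<integral>\<^sup>+ z. ennreal (cmod (fourier_transform m z) powr (2 / \<theta>) *
                              norm z powr (s / \<theta> - real DIM('a))) \<partial>lborel) \<theta>)"

text \<open>
  Suprema are taken in \<^typ>\<open>ennreal\<close>, so that \<open>Sup {} = 0\<close>.
\<close>
definition fourier_spectrum :: "real \<Rightarrow> 'a::euclidean_space measure \<Rightarrow> ennreal" where
  "fourier_spectrum \<theta> m = Sup {ennreal s |s. s \<ge> 0 \<and> energy s \<theta> m < \<infinity>}"

definition fourier_dim :: "'a::euclidean_space measure \<Rightarrow> ennreal" where
  "fourier_dim m =
     Sup {ennreal s |s. s \<ge> 0 \<and>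
            (\<exists>c>0. \<forall>z. z \<noteq> 0 \<longrightarrow> cmod (fourier_transform m z) \<le> c * norm z powr (- s / 2))}"

lemma fourier_dim_eq_fourier_spectrum_0: "fourier_dim m = fourier_spectrum 0 m"
proof -
  have "(\<exists>c>0. \<forall>z. z \<noteq> 0 \<longrightarrow> cmod (fourier_transform m z) \<le> c * norm z powr (- s / 2))
        \<longleftrightarrow> energy s 0 m < \<infinity>" (is "?L \<longleftrightarrow> ?R") for s
  proof
    assume ?L
    then obtain c where c: "c > 0"
      "\<And>z. z \<noteq> 0 \<Longrightarrow> cmod (fourier_transform m z) \<le> c * norm z powr (- s / 2)"
      by blast
    have "(cmod (fourier_transform m z))\<^sup>2 * norm z powr s \<le> c\<^sup>2" for z
    proof (cases "z = 0")
      case False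
      have "(cmod (fourier_transform m z))\<^sup>2 \<le> (c * norm z powr (- s / 2))\<^sup>2"
        using c False by (intro power_mono) auto
      also have "\<dots> = c\<^sup>2 * norm z powr (- s)"
        by (simp add: power_mult_distrib power2_eq_square flip: powr_add)
      finally have "(cmod (fourier_transform m z))\<^sup>2 * norm z powr s
          \<le> c\<^sup>2 * norm z powr (- s) * norm z powr s"
        by (intro mult_right_mono) auto
      also have "\<dots> = c\<^sup>2"
        using False by (simp add: powr_minus)
      finally show ?thesis .
    qed simp
    then have "energy s 0 m \<le> ennreal (c\<^sup>2)"
      unfolding energy_def by (auto intro!: SUP_least ennreal_leI)
    then show ?R
      by (simp add: le_less_trans)
  next
    assume R: ?R
    define C where "C = enn2real (energy s 0 m)"
    have C: "(cmod (fourier_transform m z))\<^sup>2 * norm z powr s \<le> C" for z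
    proof -
      have "ennreal ((cmod (fourier_transform m z))\<^sup>2 * norm z powr s) \<le> energy s 0 m"
        unfolding energy_def by (auto intro: SUP_upper)
      also have "\<dots> = ennreal C"
        using R by (simp add: C_def)
      finally show ?thesis
        by (subst (asm) ennreal_le_iff) (auto simp: C_def)
    qed
    have "cmod (fourier_transform m z) \<le> sqrt (C + 1) * norm z powr (- s / 2)" if "z \<noteq> 0" for z
    proof (rule power2_le_imp_le)
      have "C \<ge> 0" by (simp add: C_def)
      have "(cmod (fourier_transform m z))\<^sup>2
          = (cmod (fourier_transform m z))\<^sup>2 * norm z powr s * norm z powr (- s)"
        using that by (simp add: powr_minus)
      also have "\<dots> \<le> (C + 1) * norm z powr (- s)"
        using C[of z] by (intro mult_right_mono) auto
      also have "\<dots> = (sqrt (C + 1) * norm z powr (- s / 2))\<^sup>2"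
        using \<open>C \<ge> 0\<close>
        by (simp add: power_mult_distrib power2_eq_square[of "_ powr _"] flip: powr_add)
      finally show "(cmod (fourier_transform m z))\<^sup>2 \<le> (sqrt (C + 1) * norm z powr (- s / 2))\<^sup>2" .
    qed (auto simp: C_def)
    moreover have "sqrt (C + 1) > 0"
      by (simp add: C_def add_nonneg_pos)
    ultimately show ?L
      by blast
  qed
  then show ?thesis
    by (simp add: fourier_dim_def fourier_spectrum_def)
qed

end

theory Submission
  imports Defs
begin

text \<open>
  Fix \<open>\<theta> > 0\<close>, put \<open>p = 2 / \<theta>\<close> and write \<open>f\<close>, \<open>g\<close> for the \<open>p\<close>-th powers of the moduli of the Fourier
  transforms of \<open>\<mu>\<close>, \<open>\<nu>\<close>.  The transform of \<open>\<mu> \<times> \<nu>\<close> is the tensor product of the two transforms, so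
  everything is about the integrals of \<open>f x * g y * |(x, y)|\<close> to the power \<open>t - k - l\<close>, with
  \<open>t = s / \<theta>\<close> and \<open>l = d - k\<close>.  As \<open>f\<close> and \<open>g\<close> are bounded and \<open>|z|\<close> to the power \<open>u - n\<close> is
  integrable near the origin of \<open>\<real>\<^sup>n\<close> for \<open>u > 0\<close>, finiteness of an energy of positive order depends
  only on the region \<open>|z| > 1\<close> (\<open>energy_finite_iff_tail_integral\<close>).  The tail integrals, unlike the energies,
  make sense for all real \<open>u\<close>, and they are finite for every \<open>u\<close> below the Fourier spectrum divided
  by \<open>\<theta>\<close>, negative \<open>u\<close> included (\<open>tail_integral_finite_below_fourier_spectrum\<close>).  This lets a spectrum
  equal to \<open>0\<close>, where no energy of positive order is finite, be treated like any other.

  Lower bound (\<open>tail_integral_product_finite\<close>).  Where \<open>|x| \<le> 1 < |y|\<close>, the norm of \<open>(x, y)\<close> is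
  comparable to \<open>|y|\<close>, so the tail of \<open>g\<close> of order \<open>t - k\<close> decides: this gives the term
  \<open>k\<theta> + dim \<nu>\<close>, and symmetrically \<open>dim \<mu> + l\<theta>\<close>.  Where both norms exceed \<open>1\<close> and \<open>t < k + l\<close>, the
  negative power of \<open>|(x, y)|\<close> is distributed onto the factors as \<open>u - k\<close> and \<open>v - l\<close> with
  \<open>u + v = t\<close>, which needs \<open>u\<close> and \<open>v\<close> below the two spectra and so produces the sum of the spectra.
  For \<open>t \<ge> k + l\<close> the power is at most a constant times the sum of the powers of \<open>|x|\<close> and \<open>|y|\<close>.

  Upper bound (\<open>tail_integral_factor_finite\<close>).  The transform of a non-zero measure is continuous and
  positive at the origin, so \<open>f\<close> is bounded below near \<open>0\<close>; integrating over such \<open>x\<close> alone recovers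
  the tail of \<open>g\<close> of order \<open>t - k\<close>.  The other upper bound follows by exchanging the factors
  (\<open>fourier_spectrum_pair_commute\<close>).

  For \<open>\<theta> = 0\<close> the same comparison of norms applies pointwise, and restricting to \<open>x = 0\<close> gives the
  upper bound; the Fourier dimension is this case.
\<close>

section \<open>Integrability of powers of the norm\<close>

lemma powr_le_of_comparable:
  fixes a b r :: real
  assumes "0 < a" "a \<le> b" "b \<le> 2 * a"
  shows "b powr r \<le> 2 powr \<bar>r\<bar> * a powr r"
    and "a powr r \<le> 2 powr \<bar>r\<bar> * b powr r"
proof -
  have 1: "1 \<le> 2 powr \<bar>r\<bar>"
    by (rule ge_one_powr_ge_zero) auto
  have q: "1 \<le> b / a" "b / a \<le> 2"
    using assms by (auto simp: field_simps)
  have up: "(b / a) powr s \<le> 2 powr \<bar>r\<bar>" if "s \<le> \<bar>r\<bar>" for s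
  proof -
    have "(b / a) powr s \<le> (b / a) powr \<bar>r\<bar>"
      using q that by (intro powr_mono) auto
    also have "\<dots> \<le> 2 powr \<bar>r\<bar>"
      using q by (intro powr_mono2) auto
    finally show ?thesis .
  qed
  have "b powr r = (b / a) powr r * a powr r"
    using assms by (simp add: powr_divide)
  then show "b powr r \<le> 2 powr \<bar>r\<bar> * a powr r"
    using up[of r] by (simp add: mult_right_mono)
  have "a powr r = (b / a) powr (- r) * b powr r"
    using assms by (simp add: powr_divide powr_minus field_simps)
  then show "a powr r \<le> 2 powr \<bar>r\<bar> * b powr r"
    using up[of "- r"] by (simp add: mult_right_mono)
qed

text \<open>
  On the \<open>j\<close>-th dyadic shell the integrand is comparable to \<open>\<rho>\<close> to the power \<open>j * w\<close>, and the volume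
  of the shell is at most a constant times \<open>\<rho>\<close> to the power \<open>j * n\<close>, so a geometric series majorises
  the integral.  Taking \<open>\<rho> = 1/2\<close> covers the unit ball and \<open>\<rho> = 2\<close> its complement.
\<close>
lemma nn_integral_norm_powr_shells_finite:
  fixes \<rho> w :: real
  assumes "0 < \<rho>" "\<rho> powr (w + real DIM('a::euclidean_space)) < 1"
  shows "(\<integral>\<^sup>+ z \<in> {z::'a. \<exists>j. \<rho> ^ j / 2 < norm z \<and> norm z \<le> \<rho> ^ j}.
             ennreal (norm z powr w) \<partial>lborel) < \<infinity>"
proof -
  let ?n = "DIM('a)"
  define q where "q = \<rho> powr (w + real ?n)"
  let ?S = "{z::'a. \<exists>j. \<rho> ^ j / 2 < norm z \<and> norm z \<le> \<rho> ^ j}"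
  define h where "h = (\<lambda>j (z::'a). ennreal (2 powr \<bar>w\<bar> * (\<rho> ^ j) powr w) * indicator (cball 0 (\<rho> ^ j)) z)"
  have h_meas: "h j \<in> borel_measurable lborel" for j
    unfolding h_def by (intro borel_measurable_times_ennreal borel_measurable_const borel_measurable_indicator) simp
  have "(\<integral>\<^sup>+ z \<in> ?S. ennreal (norm z powr w) \<partial>lborel) \<le> (\<integral>\<^sup>+ z. (\<Sum>j. h j z) \<partial>lborel)"
  proof (intro nn_integral_mono)
    fix z :: 'a
    show "ennreal (norm z powr w) * indicator ?S z \<le> (\<Sum>j. h j z)"
    proof (cases "z \<in> ?S")
      case True
      then obtain j where j: "\<rho> ^ j / 2 < norm z" "norm z \<le> \<rho> ^ j" by auto
      have "0 < norm z" using j assms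
        by (smt (verit) divide_pos_pos zero_less_power)
      then have "norm z powr w \<le> 2 powr \<bar>w\<bar> * (\<rho> ^ j) powr w"
        using powr_le_of_comparable(2)[of "norm z" "\<rho> ^ j" w] j by auto
      then have "ennreal (norm z powr w) * 1 \<le> ennreal (2 powr \<bar>w\<bar> * (\<rho> ^ j) powr w) * 1"
        by (intro mult_right_mono ennreal_leI) simp_all
      also have "\<dots> = h j z"
        using j(2) by (simp only: h_def indicator_simps mem_cball_0)
      also have "\<dots> = (\<Sum>i\<in>{j}. h i z)"
        by simp
      also have "\<dots> \<le> (\<Sum>j. h j z)"
        by (rule sum_le_suminf) (rule summableI, simp, simp)
      finally have "ennreal (norm z powr w) * indicator ?S z \<le> (\<Sum>j. h j z)"
        using True by (simp only: indicator_simps)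
      then show ?thesis .
    qed simp
  qed
  also have "\<dots> = (\<Sum>j. \<integral>\<^sup>+ z. h j z \<partial>lborel)"
    by (rule nn_integral_suminf) (rule h_meas)
  also have "\<dots> = (\<Sum>j. ennreal (2 powr \<bar>w\<bar> * unit_ball_vol ?n * q ^ j))"
  proof (rule suminf_cong)
    fix j
    have "(\<integral>\<^sup>+ z. h j z \<partial>lborel)
        = ennreal (2 powr \<bar>w\<bar> * (\<rho> ^ j) powr w) * ennreal (unit_ball_vol ?n * (\<rho> ^ j) ^ ?n)"
      unfolding h_def using assms(1) by (subst nn_integral_cmult_indicator) (simp_all add: emeasure_cball)
    also have "\<dots> = ennreal (2 powr \<bar>w\<bar> * (\<rho> ^ j) powr w * (unit_ball_vol ?n * (\<rho> ^ j) ^ ?n))"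
      using assms by (intro ennreal_mult[symmetric]) auto
    also have "(\<rho> ^ j) ^ ?n = (\<rho> ^ j) powr real ?n"
      using assms by (simp add: powr_realpow)
    also have "2 powr \<bar>w\<bar> * (\<rho> ^ j) powr w * (unit_ball_vol ?n * (\<rho> ^ j) powr real ?n)
        = 2 powr \<bar>w\<bar> * unit_ball_vol ?n * (\<rho> ^ j) powr (w + real ?n)"
      by (simp add: powr_add)
    also have "(\<rho> ^ j) powr (w + real ?n) = \<rho> powr (real j * (w + real ?n))"
      using assms(1) by (metis powr_powr powr_realpow)
    also have "\<dots> = q ^ j"
      unfolding q_def using assms(1) by (subst powr_power) auto
    finally show "(\<integral>\<^sup>+ z. h j z \<partial>lborel) = ennreal (2 powr \<bar>w\<bar> * unit_ball_vol ?n * q ^ j)" .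
  qed
  also have "\<dots> < \<infinity>"
  proof -
    have "summable (\<lambda>j. 2 powr \<bar>w\<bar> * unit_ball_vol ?n * q ^ j)"
      using assms by (intro summable_mult summable_geometric) (auto simp: q_def)
    then show ?thesis
      by (subst suminf_ennreal2) (auto simp: q_def)
  qed
  finally show ?thesis .
qed

lemma nn_integral_norm_powr_cball_finite:
  assumes "0 < u"
  shows "(\<integral>\<^sup>+ z \<in> cball 0 1. ennreal (norm (z::'a::euclidean_space) powr (u - real DIM('a))) \<partial>lborel) < \<infinity>"
    (is "?I < _")
proof -
  let ?S = "{z::'a. \<exists>j. (1/2::real) ^ j / 2 < norm z \<and> norm z \<le> (1/2) ^ j}"
  have "z \<in> ?S" if z: "z \<in> cball 0 1" "z \<noteq> 0" for z :: 'a
  proof -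
    obtain i where "(1/2::real) ^ i < norm z"
      using real_arch_pow_inv[of "norm z" "1/2"] z(2) by auto
    moreover have "(1/2::real) ^ Suc i \<le> (1/2) ^ i"
      by simp
    ultimately have ex: "\<exists>j. (1/2::real) ^ Suc j < norm z"
      using le_less_trans by blast
    define j where "j = (LEAST j. (1/2::real) ^ Suc j < norm z)"
    have 1: "(1/2::real) ^ Suc j < norm z"
      unfolding j_def by (rule LeastI_ex[OF ex])
    have "norm z \<le> (1/2) ^ j"
    proof (cases j)
      case 0 then show ?thesis using z by auto
    next
      case (Suc i)
      then have "\<not> (1/2::real) ^ Suc i < norm z"
        using not_less_Least[of i "\<lambda>j. (1/2::real) ^ Suc j < norm z"] by (auto simp: j_def)
      then show ?thesis using Suc by simp
    qed
    then show ?thesis using 1 by auto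
  qed
  then have "?I \<le> (\<integral>\<^sup>+ z \<in> ?S. ennreal (norm z powr (u - real DIM('a))) \<partial>lborel)"
    by (intro nn_integral_mono) (auto split: split_indicator)
  also have "\<dots> < \<infinity>"
    using assms powr01_less_one[of "1/2" u]
    by (intro nn_integral_norm_powr_shells_finite) simp_all
  finally show ?thesis .
qed

lemma nn_integral_norm_powr_outside_finite:
  assumes "u < 0"
  shows "(\<integral>\<^sup>+ z \<in> {z. 1 < norm z}. ennreal (norm (z::'a::euclidean_space) powr (u - real DIM('a))) \<partial>lborel) < \<infinity>"
    (is "?I < _")
proof -
  let ?S = "{z::'a. \<exists>j. (2::real) ^ j / 2 < norm z \<and> norm z \<le> 2 ^ j}"
  have "z \<in> ?S" if "1 < norm z" for z :: 'a
  proof -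
    have ex: "\<exists>j. norm z \<le> (2::real) ^ j"
      using real_arch_pow[of 2 "norm z"] by (auto intro: less_imp_le)
    define j where "j = (LEAST j. norm z \<le> (2::real) ^ j)"
    have 1: "norm z \<le> (2::real) ^ j"
      unfolding j_def by (rule LeastI_ex[OF ex])
    have "2 ^ j / 2 < norm z"
    proof (cases j)
      case 0 then show ?thesis using that by auto
    next
      case (Suc i)
      then have "\<not> norm z \<le> (2::real) ^ i"
        using not_less_Least[of i "\<lambda>j. norm z \<le> (2::real) ^ j"] by (auto simp: j_def)
      then show ?thesis using Suc by simp
    qed
    then show ?thesis using 1 by auto
  qed
  then have "?I \<le> (\<integral>\<^sup>+ z \<in> ?S. ennreal (norm z powr (u - real DIM('a))) \<partial>lborel)"
    by (intro nn_integral_mono) (auto split: split_indicator)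
  also have "\<dots> < \<infinity>"
    using assms powr_less_cancel_iff[of 2 u 0]
    by (intro nn_integral_norm_powr_shells_finite) simp_all
  finally show ?thesis .
qed

section \<open>Fourier transforms of finite measures\<close>

lemma integrable_fourier_kernel:
  fixes m :: "'a::euclidean_space measure"
  assumes [measurable_cong]: "sets m = sets borel" and "finite_measure m"
  shows "integrable m (\<lambda>x. exp (- 2 * complex_of_real pi * \<i> * complex_of_real (z \<bullet> x)))"
proof -
  interpret finite_measure m by fact
  show ?thesis
    by (rule integrable_const_bound[where B = 1]) (simp_all add: norm_exp_eq_Re)
qed

lemma cmod_fourier_transform_le:
  fixes m :: "'a::euclidean_space measure"
  assumes "sets m = sets borel" "finite_measure m"
  shows "cmod (fourier_transform m z) \<le> measure m UNIV"
proof -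
  have sp: "space m = UNIV" using sets_eq_imp_space_eq[OF assms(1)] by simp
  have "cmod (fourier_transform m z) \<le> (\<integral>x. norm (exp (- 2 * complex_of_real pi * \<i> * complex_of_real (z \<bullet> x))) \<partial>m)"
    unfolding fourier_transform_def by (rule integral_norm_bound)
  then show ?thesis by (simp add: sp norm_exp_eq_Re)
qed

lemma fourier_transform_0:
  fixes m :: "'a::euclidean_space measure"
  assumes "sets m = sets borel"
  shows "fourier_transform m 0 = complex_of_real (measure m UNIV)"
  using sets_eq_imp_space_eq[OF assms] by (simp add: fourier_transform_def scaleR_conv_of_real)

lemma continuous_on_fourier_transform:
  fixes m :: "'a::euclidean_space measure"
  assumes [measurable_cong]: "sets m = sets borel" and "finite_measure m"
  shows "continuous_on UNIV (fourier_transform m)"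
proof -
  interpret finite_measure m by fact
  have "(\<lambda>n. fourier_transform m (X n)) \<longlonglongrightarrow> fourier_transform m z" if "X \<longlonglongrightarrow> z" for X z
    unfolding fourier_transform_def
  proof (rule integral_dominated_convergence[where w = "\<lambda>_. 1"])
    show "AE x in m. (\<lambda>n. exp (- 2 * complex_of_real pi * \<i> * complex_of_real (X n \<bullet> x)))
            \<longlonglongrightarrow> exp (- 2 * complex_of_real pi * \<i> * complex_of_real (z \<bullet> x))"
      using that by (intro AE_I2 tendsto_intros)
  qed (simp_all add: norm_exp_eq_Re)
  then show ?thesis
    by (auto simp: continuous_on_sequentially o_def)
qed

lemma fourier_transform_pair_measure:
  fixes \<mu> :: "'a::euclidean_space measure" and \<nu> :: "'b::euclidean_space measure"
  assumes \<mu>: "sets \<mu> = sets borel" "finite_measure \<mu>"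
    and \<nu>: "sets \<nu> = sets borel" "finite_measure \<nu>"
  shows "sets (\<mu> \<Otimes>\<^sub>M \<nu>) = sets borel" "finite_measure (\<mu> \<Otimes>\<^sub>M \<nu>)"
    and "fourier_transform (\<mu> \<Otimes>\<^sub>M \<nu>) (x, y) = fourier_transform \<mu> x * fourier_transform \<nu> y"
proof -
  interpret \<mu>: finite_measure \<mu> by fact
  interpret \<nu>: finite_measure \<nu> by fact
  interpret pair_sigma_finite \<mu> \<nu> ..
  show s: "sets (\<mu> \<Otimes>\<^sub>M \<nu>) = sets borel"
    using sets_pair_measure_cong[OF \<mu>(1) \<nu>(1)] by (simp only: borel_prod)
  show f: "finite_measure (\<mu> \<Otimes>\<^sub>M \<nu>)"
    by (rule finite_measure_pair_measure) unfold_locales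
  let ?e = "\<lambda>t. exp (- 2 * complex_of_real pi * \<i> * complex_of_real t)"
  have "fourier_transform (\<mu> \<Otimes>\<^sub>M \<nu>) (x, y) = (\<integral>a. \<integral>b. ?e ((x, y) \<bullet> (a, b)) \<partial>\<nu> \<partial>\<mu>)"
    unfolding fourier_transform_def
    by (rule integral_fst'[symmetric]) (rule integrable_fourier_kernel[OF s f])
  also have "\<dots> = (\<integral>a. \<integral>b. ?e (x \<bullet> a) * ?e (y \<bullet> b) \<partial>\<nu> \<partial>\<mu>)"
    by (simp add: distrib_left flip: exp_add)
  also have "\<dots> = fourier_transform \<mu> x * fourier_transform \<nu> y"
    by (simp add: fourier_transform_def)
  finally show "fourier_transform (\<mu> \<Otimes>\<^sub>M \<nu>) (x, y) = fourier_transform \<mu> x * fourier_transform \<nu> y" .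
qed

section \<open>Tail integrals\<close>

lemma cball_measurable [measurable]: "cball (x::'a::euclidean_space) r \<in> sets borel"
  by (rule borel_closed) simp

lemma nn_integral_lborel_Pair:
  fixes h :: "'a::euclidean_space \<times> 'b::euclidean_space \<Rightarrow> ennreal"
  assumes "h \<in> borel_measurable borel"
  shows "(\<integral>\<^sup>+ z. h z \<partial>lborel) = (\<integral>\<^sup>+ x. \<integral>\<^sup>+ y. h (x, y) \<partial>lborel \<partial>lborel)"
    and "(\<integral>\<^sup>+ z. h z \<partial>lborel) = (\<integral>\<^sup>+ y. \<integral>\<^sup>+ x. h (x, y) \<partial>lborel \<partial>lborel)"
proof -
  have h: "h \<in> borel_measurable (lborel \<Otimes>\<^sub>M lborel)"
    using assms by (simp add: lborel_prod)
  show "(\<integral>\<^sup>+ z. h z \<partial>lborel) = (\<integral>\<^sup>+ x. \<integral>\<^sup>+ y. h (x, y) \<partial>lborel \<partial>lborel)"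
    using lborel.nn_integral_fst[OF h] by (simp add: lborel_prod)
  show "(\<integral>\<^sup>+ z. h z \<partial>lborel) = (\<integral>\<^sup>+ y. \<integral>\<^sup>+ x. h (x, y) \<partial>lborel \<partial>lborel)"
    using lborel_pair.nn_integral_snd[OF h] by (simp add: lborel_prod)
qed

lemma nn_integral_lborel_times_finite:
  fixes P :: "'a::euclidean_space \<Rightarrow> real" and Q :: "'b::euclidean_space \<Rightarrow> real"
  assumes [measurable]: "P \<in> borel_measurable borel" "Q \<in> borel_measurable borel"
    and nonneg: "\<And>x. 0 \<le> P x" "\<And>y. 0 \<le> Q y"
    and fin: "(\<integral>\<^sup>+ x. ennreal (P x) \<partial>lborel) < \<infinity>" "(\<integral>\<^sup>+ y. ennreal (Q y) \<partial>lborel) < \<infinity>"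
  shows "(\<integral>\<^sup>+ z. ennreal (P (fst z) * Q (snd z)) \<partial>lborel) < \<infinity>"
proof -
  have "(\<integral>\<^sup>+ z. ennreal (P (fst z) * Q (snd z)) \<partial>lborel)
      = (\<integral>\<^sup>+ x. \<integral>\<^sup>+ y. ennreal (P x) * ennreal (Q y) \<partial>lborel \<partial>lborel)"
    using nonneg by (subst nn_integral_lborel_Pair(1)) (auto simp: ennreal_mult borel_prod[symmetric])
  also have "\<dots> = (\<integral>\<^sup>+ x. ennreal (P x) \<partial>lborel) * (\<integral>\<^sup>+ y. ennreal (Q y) \<partial>lborel)"
    by (simp add: nn_integral_cmult nn_integral_multc)
  also have "\<dots> < \<infinity>"
    using fin by (simp add: ennreal_mult_less_top)
  finally show ?thesis .
qed

text \<open>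
  The exponent is normalised so that \<open>u = s / \<theta>\<close> matches the order \<open>s\<close> of an energy; negative \<open>u\<close>
  are meaningful because the origin is cut out.
\<close>
definition tail_integral :: "('a::euclidean_space \<Rightarrow> real) \<Rightarrow> real \<Rightarrow> ennreal" where
  "tail_integral f u =
     (\<integral>\<^sup>+ z. ennreal (f z * norm z powr (u - real DIM('a)) * indicator {z. 1 < norm z} z) \<partial>lborel)"

lemma tail_integral_mono:
  fixes f :: "'a::euclidean_space \<Rightarrow> real"
  assumes "\<And>x. 0 \<le> f x" "u \<le> v"
  shows "tail_integral f u \<le> tail_integral f v"
  unfolding tail_integral_def using assms
  by (intro nn_integral_mono ennreal_leI)
     (auto intro!: mult_left_mono powr_mono split: split_indicator)

lemma tail_integral_finite_of_neg:
  fixes f :: "'a::euclidean_space \<Rightarrow> real"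
  assumes "\<And>x. 0 \<le> f x" "\<And>x. f x \<le> M" "u < 0"
  shows "tail_integral f u < \<infinity>"
proof -
  let ?w = "u - real DIM('a)"
  have "0 \<le> M" using assms(1,2)[of 0] by linarith
  have "tail_integral f u \<le> (\<integral>\<^sup>+ z. ennreal M * (ennreal (norm (z::'a) powr ?w) * indicator {z. 1 < norm z} z) \<partial>lborel)"
    unfolding tail_integral_def using assms \<open>0 \<le> M\<close>
    by (intro nn_integral_mono)
       (auto split: split_indicator simp: mult_right_mono simp flip: ennreal_mult)
  also have "\<dots> = ennreal M * (\<integral>\<^sup>+ z \<in> {z. 1 < norm z}. ennreal (norm (z::'a) powr ?w) \<partial>lborel)"
    by (rule nn_integral_cmult) measurable
  also have "\<dots> < \<infinity>"
    using nn_integral_norm_powr_outside_finite[OF assms(3), where 'a = 'a]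
    by (simp add: ennreal_mult_less_top)
  finally show ?thesis .
qed

lemma nn_integral_finite_iff_tail_integral:
  fixes f :: "'a::euclidean_space \<Rightarrow> real"
  assumes [measurable]: "f \<in> borel_measurable borel"
    and f: "\<And>x. 0 \<le> f x" "\<And>x. f x \<le> M" and "0 < u"
  shows "(\<integral>\<^sup>+ z. ennreal (f z * norm z powr (u - real DIM('a))) \<partial>lborel) < \<infinity>
     \<longleftrightarrow> tail_integral f u < \<infinity>" (is "?I < _ \<longleftrightarrow> _")
proof
  assume "?I < \<infinity>"
  have "tail_integral f u \<le> ?I"
    unfolding tail_integral_def using f
    by (intro nn_integral_mono ennreal_leI) (auto split: split_indicator)
  then show "tail_integral f u < \<infinity>" using \<open>?I < \<infinity>\<close> by (rule le_less_trans)
next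
  assume fin: "tail_integral f u < \<infinity>"
  let ?w = "u - real DIM('a)"
  let ?N = "\<lambda>z::'a. ennreal (norm z powr ?w) * indicator (cball 0 1) z"
  let ?T = "\<lambda>z::'a. ennreal (f z * norm z powr ?w * indicator {z. 1 < norm z} z)"
  have "0 \<le> M" using f[of 0] by linarith
  have "?I \<le> (\<integral>\<^sup>+ z. ennreal M * ?N z + ?T z \<partial>lborel)"
    using f \<open>0 \<le> M\<close>
    by (intro nn_integral_mono)
       (auto split: split_indicator simp: mult_right_mono simp flip: ennreal_mult)
  also have "\<dots> = (\<integral>\<^sup>+ z. ennreal M * ?N z \<partial>lborel) + (\<integral>\<^sup>+ z. ?T z \<partial>lborel)"
    by (rule nn_integral_add) measurable
  also have "(\<integral>\<^sup>+ z. ennreal M * ?N z \<partial>lborel) = ennreal M * (\<integral>\<^sup>+ z. ?N z \<partial>lborel)"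
    by (rule nn_integral_cmult) measurable
  finally have "?I \<le> ennreal M * (\<integral>\<^sup>+ z. ?N z \<partial>lborel) + tail_integral f u"
    unfolding tail_integral_def .
  also have "\<dots> < \<infinity>"
    using nn_integral_norm_powr_cball_finite[OF \<open>0 < u\<close>, where 'a = 'a] fin
    by (simp add: ennreal_mult_less_top)
  finally show "?I < \<infinity>" .
qed

lemma nn_integral_add_finite:
  fixes P Q :: "'a::euclidean_space \<Rightarrow> real"
  assumes "P \<in> borel_measurable borel" "Q \<in> borel_measurable borel"
    and "\<And>x. 0 \<le> P x" "\<And>x. 0 \<le> Q x"
    and "(\<integral>\<^sup>+ x. ennreal (P x) \<partial>lborel) < \<infinity>" "(\<integral>\<^sup>+ x. ennreal (Q x) \<partial>lborel) < \<infinity>"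
  shows "(\<integral>\<^sup>+ x. ennreal (P x + Q x) \<partial>lborel) < \<infinity>"
  using assms by (simp add: nn_integral_add)

lemma nn_integral_cmult_finite:
  fixes P :: "'a::euclidean_space \<Rightarrow> real"
  assumes "P \<in> borel_measurable borel" "0 \<le> c" "(\<integral>\<^sup>+ x. ennreal (P x) \<partial>lborel) < \<infinity>"
  shows "(\<integral>\<^sup>+ x. ennreal (c * P x) \<partial>lborel) < \<infinity>"
  using assms by (simp add: ennreal_mult' nn_integral_cmult ennreal_mult_less_top)

section \<open>Tail integrals of tensor products\<close>

text \<open>
  The norm of \<open>(x, y)\<close> lies between \<open>|y|\<close> and \<open>2 * |y|\<close>.
\<close>
lemma norm_Pair_powr_comparable:
  fixes x :: "'a::real_normed_vector" and y :: "'b::real_normed_vector"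
  assumes "norm x \<le> norm y" "y \<noteq> 0"
  shows "norm (x, y) powr r \<le> 2 powr \<bar>r\<bar> * norm y powr r"
    and "norm y powr r \<le> 2 powr \<bar>r\<bar> * norm (x, y) powr r"
proof -
  have "norm y \<le> norm (x, y)" "norm (x, y) \<le> 2 * norm y"
    using norm_snd_le[of y x] norm_Pair_le[of x y] assms by auto
  then show "norm (x, y) powr r \<le> 2 powr \<bar>r\<bar> * norm y powr r"
    and "norm y powr r \<le> 2 powr \<bar>r\<bar> * norm (x, y) powr r"
    using powr_le_of_comparable[of "norm y" "norm (x, y)" r] assms by auto
qed

lemma norm_Pair_commute: "norm (x, y) = norm (y, x)"
  by (simp add: norm_Pair add.commute)

text \<open>
  The integrand is majorised by a sum \<open>H\<close> of products of a function of \<open>x\<close> and a function of \<open>y\<close>,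
  which come from the four regions cut out by \<open>|x| \<le> 1\<close> or \<open>|x| > 1\<close> and \<open>|y| \<le> 1\<close> or \<open>|y| > 1\<close>;
  each product has finite integral by Tonelli.  The hypotheses \<open>tf\<close> and \<open>tg\<close> handle the regions where
  exactly one variable is large.  Where both are large and the exponent \<open>t - k - l\<close> is negative, the
  hypothesis \<open>split\<close> distributes it; when it is not negative, the tails of orders \<open>k\<close> and \<open>l\<close> are
  finite by monotonicity and a distribution with an exponent \<open>0\<close> is available.
\<close>
lemma tail_integral_product_finite:
  fixes f :: "'a::euclidean_space \<Rightarrow> real" and g :: "'b::euclidean_space \<Rightarrow> real"
  assumes meas [measurable]: "f \<in> borel_measurable borel" "g \<in> borel_measurable borel"
    and f: "\<And>x. 0 \<le> f x" "\<And>x. f x \<le> M" and g: "\<And>y. 0 \<le> g y" "\<And>y. g y \<le> N"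
    and tf: "tail_integral f (t - real DIM('b)) < \<infinity>"
    and tg: "tail_integral g (t - real DIM('a)) < \<infinity>"
    and split: "t < real DIM('a) + real DIM('b) \<Longrightarrow>
          \<exists>u\<le>real DIM('a). \<exists>v\<le>real DIM('b). u + v = t \<and>
             tail_integral f u < \<infinity> \<and> tail_integral g v < \<infinity>"
  shows "tail_integral (\<lambda>z. f (fst z) * g (snd z)) t < \<infinity>"
proof -
  define k where "k = real DIM('a)"
  define l where "l = real DIM('b)"
  define r where "r = t - (k + l)"
  define c where "c = 2 powr \<bar>r\<bar>"
  have c: "0 \<le> c" "1 \<le> c"
    unfolding c_def by (simp_all add: ge_one_powr_ge_zero)
  have MN: "0 \<le> M" "0 \<le> N" using f[of 0] g[of 0] by linarith+
  define A where "A = (\<lambda>x::'a. indicator (cball 0 1) x :: real)"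
  define B where "B = (\<lambda>y::'b. indicator (cball 0 1) y :: real)"
  define F where "F = (\<lambda>u (x::'a). f x * norm x powr (u - k) * indicator {x. 1 < norm x} x)"
  define G where "G = (\<lambda>v (y::'b). g y * norm y powr (v - l) * indicator {y. 1 < norm y} y)"
  have F: "tail_integral f u = (\<integral>\<^sup>+ x. ennreal (F u x) \<partial>lborel)" for u
    by (simp add: F_def tail_integral_def k_def)
  have G: "tail_integral g v = (\<integral>\<^sup>+ y. ennreal (G v y) \<partial>lborel)" for v
    by (simp add: G_def tail_integral_def l_def)
  have [measurable]: "F u \<in> borel_measurable borel" "G u \<in> borel_measurable borel" for u
    unfolding F_def G_def by measurable
  have [measurable]: "A \<in> borel_measurable borel" "B \<in> borel_measurable borel"
    unfolding A_def B_def by measurable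
  have nonneg: "0 \<le> A x" "0 \<le> B y" "0 \<le> F u x" "0 \<le> G u y" for x y u
    using f g by (auto simp: A_def B_def F_def G_def)
  have A_fin: "(\<integral>\<^sup>+ x. ennreal (A x) \<partial>lborel) < \<infinity>"
    by (simp add: A_def ennreal_indicator emeasure_cball)
  have B_fin: "(\<integral>\<^sup>+ x. ennreal (B x) \<partial>lborel) < \<infinity>"
    by (simp add: B_def ennreal_indicator emeasure_cball)
  note prod_fin = nn_integral_lborel_times_finite[OF _ _ nonneg(1) nonneg(2) A_fin B_fin]
    nn_integral_lborel_times_finite[OF _ _ nonneg(1) nonneg(4) A_fin]
    nn_integral_lborel_times_finite[OF _ _ nonneg(3) nonneg(2) _ B_fin]
    nn_integral_lborel_times_finite[OF _ _ nonneg(3) nonneg(4)]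
  \<comment> \<open>The region where both variables are large. Two product terms are provided because for
    \<open>t \<ge> k + l\<close> the bound is by a sum of a power of \<open>|x|\<close> and a power of \<open>|y|\<close>.\<close>
  obtain u1 v1 u2 v2 where far:
      "tail_integral f u1 < \<infinity>" "tail_integral g v1 < \<infinity>"
      "tail_integral f u2 < \<infinity>" "tail_integral g v2 < \<infinity>"
      "\<And>x y. 1 < norm (x::'a) \<Longrightarrow> 1 < norm (y::'b) \<Longrightarrow>
          norm (x, y) powr r \<le> c * (norm x powr (u1 - k) * norm y powr (v1 - l)
             + norm x powr (u2 - k) * norm y powr (v2 - l))"
  proof (cases "t < k + l")
    case True
    then obtain u v where uv: "u \<le> k" "v \<le> l" "u + v = t"
        "tail_integral f u < \<infinity>" "tail_integral g v < \<infinity>"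
      using split unfolding k_def l_def by blast
    have "norm (x, y) powr r \<le> c * (norm x powr (u - k) * norm y powr (v - l)
             + norm x powr (u - k) * norm y powr (v - l))"
      if "1 < norm x" "1 < norm y" for x :: 'a and y :: 'b
    proof -
      have "norm (x, y) powr r = norm (x, y) powr (u - k) * norm (x, y) powr (v - l)"
        using uv(3) by (simp add: r_def algebra_simps flip: powr_add)
      also have "\<dots> \<le> norm x powr (u - k) * norm y powr (v - l)"
        using uv that norm_fst_le[of x y] norm_snd_le[of y x]
        by (intro mult_mono powr_mono2') (auto simp del: norm_Pair)
      also have "\<dots> \<le> c * (norm x powr (u - k) * norm y powr (v - l))"
        using mult_right_mono[OF c(2), of "norm x powr (u - k) * norm y powr (v - l)"] by simp
      also have "\<dots> \<le> c * (norm x powr (u - k) * norm y powr (v - l)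
             + norm x powr (u - k) * norm y powr (v - l))"
        using c by (intro mult_left_mono) auto
      finally show ?thesis .
    qed
    then show ?thesis using that uv by blast
  next
    case False
    have "tail_integral f k \<le> tail_integral f (t - l)" "tail_integral g l \<le> tail_integral g (t - k)"
      using False f g by (auto intro!: tail_integral_mono)
    then have kl: "tail_integral f k < \<infinity>" "tail_integral g l < \<infinity>"
      using tf tg by (auto simp: k_def l_def)
    have "norm (x, y) powr r \<le> c * (norm x powr (t - l - k) * norm y powr (l - l)
             + norm x powr (k - k) * norm y powr (t - k - l))"
      if "1 < norm x" "1 < norm y" for x :: 'a and y :: 'b
    proof -
      have r: "t - l - k = r" "t - k - l = r" by (auto simp: r_def)
      have nz: "x \<noteq> 0" "y \<noteq> 0" using that by auto
      have "norm (x, y) powr r \<le> c * norm x powr r \<or> norm (x, y) powr r \<le> c * norm y powr r"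
        using norm_Pair_powr_comparable(1)[of x y r] norm_Pair_powr_comparable(1)[of y x r] nz
        unfolding c_def by (metis linear norm_Pair_commute)
      then show ?thesis
        using c nz unfolding r by (auto simp: distrib_left intro: add_increasing add_increasing2)
    qed
    then show ?thesis using that[of "t - l" l k "t - k"] tf tg kl
      by (auto simp: k_def l_def)
  qed
  define H where "H = (\<lambda>z::'a \<times> 'b. 
       c * M * N * (A (fst z) * B (snd z)) + c * M * (A (fst z) * G (t - k) (snd z))
     + c * N * (F (t - l) (fst z) * B (snd z))
     + c * (F u1 (fst z) * G v1 (snd z)) + c * (F u2 (fst z) * G v2 (snd z)))"
  have "tail_integral (\<lambda>z. f (fst z) * g (snd z)) t \<le> (\<integral>\<^sup>+ z. ennreal (H z) \<partial>lborel)"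
    unfolding tail_integral_def
  proof (intro nn_integral_mono ennreal_leI)
    fix z :: "'a \<times> 'b"
    obtain x y where z: "z = (x, y)" by fastforce
    have dim: "t - real DIM('a \<times> 'b) = r" by (simp add: r_def k_def l_def)
    have ek: "t - k - l = r" "t - l - k = r" by (auto simp: r_def)
    have terms: "0 \<le> c * M * N * (A x * B y)" "0 \<le> c * M * (A x * G (t - k) y)"
       "0 \<le> c * N * (F (t - l) x * B y)" "0 \<le> c * (F u1 x * G v1 y)" "0 \<le> c * (F u2 x * G v2 y)"
      using nonneg c MN by auto
    show "f (fst z) * g (snd z) * norm z powr (t - real DIM('a \<times> 'b)) * indicator {z. 1 < norm z} z \<le> H z"
    proof (cases "1 < norm z")
      case True
      consider "norm x \<le> 1" "norm y \<le> 1" | "norm x \<le> 1" "1 < norm y"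
        | "1 < norm x" "norm y \<le> 1" | "1 < norm x" "1 < norm y" by linarith
      then have "f x * g y * norm (x, y) powr r \<le> H z"
      proof cases
        case 1
        have "norm (x, y) \<le> 2" using norm_Pair_le[of x y] 1 by linarith
        then have "norm (x, y) powr r \<le> c * 1 powr r"
          unfolding c_def using True z by (intro powr_le_of_comparable(1)) auto
        then have "f x * g y * norm (x, y) powr r \<le> M * N * c"
          using f g MN by (intro mult_mono) auto
        also have "\<dots> = c * M * N * (A x * B y)"
          using 1 by (simp add: A_def B_def)
        finally show ?thesis using terms unfolding H_def z by simp
      next
        case 2
        have "norm (x, y) powr r \<le> c * norm y powr r"
          unfolding c_def using 2 by (intro norm_Pair_powr_comparable(1)) auto
        then have "f x * g y * norm (x, y) powr r \<le> M * g y * (c * norm y powr r)"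
          using f g MN by (intro mult_mono) auto
        also have "\<dots> = c * M * (A x * G (t - k) y)"
          using 2 by (simp add: A_def G_def ek)
        finally show ?thesis using terms unfolding H_def z by simp
      next
        case 3
        have "norm (y, x) powr r \<le> c * norm x powr r"
          unfolding c_def using 3 by (intro norm_Pair_powr_comparable(1)) auto
        then have "f x * g y * norm (x, y) powr r \<le> f x * N * (c * norm x powr r)"
          using f g MN unfolding norm_Pair_commute[of x y] by (intro mult_mono) auto
        also have "\<dots> = c * N * (F (t - l) x * B y)"
          using 3 by (simp add: B_def F_def ek)
        finally show ?thesis using terms unfolding H_def z by simp
      next
        case 4
        have "f x * g y * norm (x, y) powr r \<le> f x * g y * (c * (norm x powr (u1 - k) * norm y powr (v1 - l)
             + norm x powr (u2 - k) * norm y powr (v2 - l)))"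
          using f g far(5)[OF 4] by (intro mult_left_mono) auto
        also have "\<dots> = c * (F u1 x * G v1 y) + c * (F u2 x * G v2 y)"
          using 4 by (simp add: F_def G_def algebra_simps)
        finally show ?thesis using terms unfolding H_def z by simp
      qed
      then show ?thesis using True by (simp add: z dim[simplified])
    next
      case False
      then show ?thesis using terms unfolding H_def z by simp
    qed
  qed
  also have "\<dots> < \<infinity>"
  proof -
    have [measurable]: "(\<lambda>z::'a \<times> 'b. P (fst z) * Q (snd z)) \<in> borel_measurable borel"
      if [measurable]: "P \<in> borel_measurable borel" "Q \<in> borel_measurable borel"
      for P :: "'a \<Rightarrow> real" and Q :: "'b \<Rightarrow> real"
      by (simp add: borel_prod[symmetric])
    show ?thesis
      unfolding H_def using nonneg c MN tf tg far(1-4) unfolding F G k_def[symmetric] l_def[symmetric]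
      by (intro nn_integral_add_finite nn_integral_cmult_finite prod_fin add_nonneg_nonneg mult_nonneg_nonneg)
         simp_all
  qed
  finally show ?thesis .
qed

text \<open>
  For \<open>x\<close> in a small ball and \<open>|y| > 1\<close> the power of \<open>|(x, y)|\<close> is at least a constant times that of
  \<open>|y|\<close>.  Integrating over this ball only bounds the tail of the product below by a positive
  constant \<open>K\<close> times the tail of \<open>g\<close>.
\<close>
lemma tail_integral_factor_finite:
  fixes f :: "'a::euclidean_space \<Rightarrow> real" and g :: "'b::euclidean_space \<Rightarrow> real"
  assumes [measurable]: "f \<in> borel_measurable borel" "g \<in> borel_measurable borel"
    and f: "\<And>x. 0 \<le> f x" and g: "\<And>y. 0 \<le> g y"
    and lower: "0 < \<delta>" "0 < a" "\<And>x. norm x \<le> \<delta> \<Longrightarrow> a \<le> f x"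
    and fin: "tail_integral (\<lambda>z. f (fst z) * g (snd z)) t < \<infinity>"
  shows "tail_integral g (t - real DIM('a)) < \<infinity>"
proof -
  define r where "r = t - real DIM('a) - real DIM('b)"
  define c where "c = 2 powr \<bar>r\<bar>"
  have c: "0 < c" by (simp add: c_def)
  \<comment> \<open>Radius at most \<open>1\<close>, so that \<open>|x| \<le> |y|\<close> whenever \<open>|y| > 1\<close>.\<close>
  define e where "e = min \<delta> 1"
  have e: "0 < e" "e \<le> \<delta>" "e \<le> 1" using lower by (auto simp: e_def)
  define K where "K = ennreal (a / c) * emeasure lborel (cball (0::'a) e)"
  define h where "h = (\<lambda>z::'a \<times> 'b. f (fst z) * g (snd z) * norm z powr r * indicator {z. 1 < norm z} z)"
  define G where "G = (\<lambda>y. g y * norm y powr r * indicator {y. 1 < norm y} y)"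
  have [measurable]: "G \<in> borel_measurable borel" unfolding G_def by measurable
  have [measurable]: "(fst :: 'a \<times> 'b \<Rightarrow> 'a) \<in> borel_measurable borel"
      "(snd :: 'a \<times> 'b \<Rightarrow> 'b) \<in> borel_measurable borel"
    by (auto intro!: borel_measurable_continuous_onI continuous_intros)
  have [measurable]: "h \<in> borel_measurable borel"
    unfolding h_def by measurable
  have "K * tail_integral g (t - real DIM('a)) = (\<integral>\<^sup>+ y. K * ennreal (G y) \<partial>lborel)"
    unfolding tail_integral_def G_def r_def by (rule nn_integral_cmult[symmetric]) measurable
  also have "\<dots> \<le> (\<integral>\<^sup>+ y. \<integral>\<^sup>+ x. ennreal (h (x, y)) \<partial>lborel \<partial>lborel)"
  proof (intro nn_integral_mono)
    fix y :: 'b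
    have "K * ennreal (G y) = ennreal (a / c) * ennreal (G y) * emeasure lborel (cball (0::'a) e)"
      by (simp add: K_def mult_ac)
    also have "\<dots> = (\<integral>\<^sup>+ x \<in> cball (0::'a) e. ennreal (a / c) * ennreal (G y) \<partial>lborel)"
      by (subst nn_integral_cmult_indicator) simp_all
    also have "\<dots> \<le> (\<integral>\<^sup>+ x. ennreal (h (x, y)) \<partial>lborel)"
    proof (intro nn_integral_mono)
      fix x :: 'a
      show "ennreal (a / c) * ennreal (G y) * indicator (cball 0 e) x \<le> ennreal (h (x, y))"
      proof (cases "norm x \<le> e \<and> 1 < norm y")
        case True
        have y: "norm y powr r \<le> c * norm (x, y) powr r"
          unfolding c_def using True e by (intro norm_Pair_powr_comparable(2)) auto
        have "a / c * G y = a * g y * (norm y powr r / c)"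
          using True by (simp add: G_def)
        also have "\<dots> \<le> f x * g y * norm (x, y) powr r"
          using True e lower(2) lower(3)[of x] f[of x] g[of y] y c
          by (intro mult_mono) (auto simp: field_simps)
        also have "\<dots> = h (x, y)"
          using True norm_snd_le[of y x] by (simp add: h_def)
        finally show ?thesis
          using True lower c by (simp add: ennreal_leI flip: ennreal_mult')
      next
        case False
        then show ?thesis by (auto simp: G_def split: split_indicator)
      qed
    qed
    finally show "K * ennreal (G y) \<le> (\<integral>\<^sup>+ x. ennreal (h (x, y)) \<partial>lborel)" .
  qed
  also have "\<dots> = (\<integral>\<^sup>+ z. ennreal (h z) \<partial>lborel)"
    by (rule nn_integral_lborel_Pair(2)[symmetric]) measurable
  also have "\<dots> = tail_integral (\<lambda>z. f (fst z) * g (snd z)) t"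
    by (simp add: tail_integral_def h_def r_def diff_diff_eq)
  finally have "K * tail_integral g (t - real DIM('a)) < \<infinity>"
    using fin by (rule le_less_trans)
  moreover have "K \<noteq> 0"
    using e lower c less_imp_neq[OF unit_ball_vol_pos[of "real DIM('a)"]]
    by (simp add: K_def emeasure_cball)
  ultimately show ?thesis
    by (auto simp: ennreal_mult_less_top less_top)
qed

section \<open>Energies and the Fourier spectrum\<close>

lemma fourier_transform_power:
  fixes m :: "'a::euclidean_space measure"
  assumes "sets m = sets borel" "finite_measure m" "0 \<le> p"
  shows "(\<lambda>z. cmod (fourier_transform m z) powr p) \<in> borel_measurable borel"
    and "cmod (fourier_transform m z) powr p \<le> measure m UNIV powr p"
proof -
  have [measurable]: "fourier_transform m \<in> borel_measurable borel"
    using continuous_on_fourier_transform[OF assms(1,2)] by (rule borel_measurable_continuous_onI)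
  show "(\<lambda>z. cmod (fourier_transform m z) powr p) \<in> borel_measurable borel"
    by measurable
  show "cmod (fourier_transform m z) powr p \<le> measure m UNIV powr p"
    using cmod_fourier_transform_le[OF assms(1,2)] assms(3) by (intro powr_mono2) auto
qed

lemma fourier_transform_power_lower_bound:
  fixes m :: "'a::euclidean_space measure"
  assumes "nonzero_finite_borel_measure m" "0 \<le> p"
  obtains \<delta> a where "0 < \<delta>" "0 < a"
    "\<And>z. norm z \<le> \<delta> \<Longrightarrow> a \<le> cmod (fourier_transform m z) powr p"
proof -
  have m: "sets m = sets borel" "finite_measure m" "emeasure m UNIV \<noteq> 0"
    using assms(1) by (auto simp: nonzero_finite_borel_measure_def)
  interpret finite_measure m by fact
  define M where "M = measure m UNIV"
  have "0 < M"
    using m(3) by (simp add: M_def emeasure_eq_measure zero_less_measure_iff)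
  have "isCont (fourier_transform m) 0"
    using continuous_on_fourier_transform[OF m(1,2)] by (simp add: continuous_on_eq_continuous_at)
  then obtain d where d: "0 < d"
      "\<And>z. norm z < d \<Longrightarrow> cmod (fourier_transform m z - complex_of_real M) < M / 2"
    using \<open>0 < M\<close> unfolding continuous_at_eps_delta fourier_transform_0[OF m(1)] M_def[symmetric]
    by (auto simp: dist_norm dest!: spec[of _ "M / 2"])
  show thesis
  proof (rule that[of "d / 2" "(M / 2) powr p"])
    fix z :: 'a assume "norm z \<le> d / 2"
    then have "cmod (fourier_transform m z - complex_of_real M) < M / 2"
      using d by auto
    then have "M / 2 \<le> cmod (fourier_transform m z)"
      using norm_triangle_ineq2[of "complex_of_real M" "fourier_transform m z"] \<open>0 < M\<close>
      by (simp add: norm_minus_commute)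
    then show "(M / 2) powr p \<le> cmod (fourier_transform m z) powr p"
      using \<open>0 < M\<close> assms(2) by (intro powr_mono2) auto
  qed (use d \<open>0 < M\<close> in auto)
qed

lemma energy_finite_iff_tail_integral:
  fixes m :: "'a::euclidean_space measure"
  assumes "sets m = sets borel" "finite_measure m" "0 < \<theta>" "0 < s"
  shows "energy s \<theta> m < \<infinity> \<longleftrightarrow>
     tail_integral (\<lambda>z. cmod (fourier_transform m z) powr (2 / \<theta>)) (s / \<theta>) < \<infinity>"
proof -
  have "energy s \<theta> m < \<infinity> \<longleftrightarrow>
     (\<integral>\<^sup>+ z. ennreal (cmod (fourier_transform m z) powr (2 / \<theta>) *
             norm z powr (s / \<theta> - real DIM('a))) \<partial>lborel) < \<infinity>"
    using assms(3) by (auto simp: energy_def ennreal_power_def less_top)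
  also have "\<dots> \<longleftrightarrow>
     tail_integral (\<lambda>z. cmod (fourier_transform m z) powr (2 / \<theta>)) (s / \<theta>) < \<infinity>"
    using assms fourier_transform_power[OF assms(1,2), of "2 / \<theta>"]
    by (intro nn_integral_finite_iff_tail_integral) auto
  finally show ?thesis .
qed

lemma ennreal_le_fourier_spectrum:
  "0 \<le> s \<Longrightarrow> energy s \<theta> m < \<infinity> \<Longrightarrow> ennreal s \<le> fourier_spectrum \<theta> m"
  unfolding fourier_spectrum_def by (rule Sup_upper) auto

lemma less_fourier_spectrumE:
  assumes "ennreal s < fourier_spectrum \<theta> m" "0 \<le> s"
  obtains s' where "s < s'" "energy s' \<theta> m < \<infinity>"
  using assms unfolding fourier_spectrum_def less_Sup_iff by (auto simp: ennreal_less_iff)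

text \<open>
  For \<open>u \<ge> 0\<close> some energy of order above \<open>u * \<theta>\<close> is finite, and tails increase with the order.  For
  \<open>u < 0\<close> boundedness of the transform suffices.  The spectrum enters through a real lower bound \<open>a\<close>
  because it may be infinite.
\<close>
lemma tail_integral_finite_below_fourier_spectrum:
  fixes m :: "'a::euclidean_space measure"
  assumes m: "sets m = sets borel" "finite_measure m" and "0 < \<theta>"
    and a: "0 \<le> a" "ennreal a \<le> fourier_spectrum \<theta> m" and u: "u < a / \<theta>"
  shows "tail_integral (\<lambda>z. cmod (fourier_transform m z) powr (2 / \<theta>)) u < \<infinity>"
proof (cases "u < 0")
  case True
  then show ?thesis
    using fourier_transform_power[OF m, of "2 / \<theta>"] \<open>0 < \<theta>\<close>
    by (intro tail_integral_finite_of_neg) auto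
next
  case False
  have "u * \<theta> < a" using u \<open>0 < \<theta>\<close> by (simp add: field_simps)
  then have "ennreal (u * \<theta>) < fourier_spectrum \<theta> m"
    using False \<open>0 < \<theta>\<close> by (intro less_le_trans[OF _ a(2)]) (simp add: ennreal_less_iff)
  moreover have nonneg: "0 \<le> u * \<theta>" using False \<open>0 < \<theta>\<close> by simp
  ultimately obtain s where s: "u * \<theta> < s" "energy s \<theta> m < \<infinity>"
    by (rule less_fourier_spectrumE)
  then have "0 < s" using nonneg by linarith
  have "u \<le> s / \<theta>" using s(1) \<open>0 < \<theta>\<close> by (simp add: field_simps)
  then have "tail_integral (\<lambda>z. cmod (fourier_transform m z) powr (2 / \<theta>)) u
      \<le> tail_integral (\<lambda>z. cmod (fourier_transform m z) powr (2 / \<theta>)) (s / \<theta>)"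
    by (intro tail_integral_mono) auto
  also have "\<dots> < \<infinity>"
    using s(2) energy_finite_iff_tail_integral[OF m \<open>0 < \<theta>\<close> \<open>0 < s\<close>] by simp
  finally show ?thesis .
qed

lemma fourier_transform_pair_measure_power:
  fixes \<mu> :: "'a::euclidean_space measure" and \<nu> :: "'b::euclidean_space measure"
  assumes "sets \<mu> = sets borel" "finite_measure \<mu>" "sets \<nu> = sets borel" "finite_measure \<nu>"
  shows "cmod (fourier_transform (\<mu> \<Otimes>\<^sub>M \<nu>) z) powr p
     = cmod (fourier_transform \<mu> (fst z)) powr p * cmod (fourier_transform \<nu> (snd z)) powr p"
  using fourier_transform_pair_measure(3)[OF assms, of "fst z" "snd z"]
  by (simp add: norm_mult powr_mult)

section \<open>Lower bound for the spectrum of a product\<close>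

text \<open>
  With \<open>a\<close>, \<open>b\<close> the two spectra and \<open>t = s / \<theta>\<close>, the three strict inequalities say that \<open>t - l\<close>,
  \<open>t - k\<close> and a suitable splitting \<open>t = u + v\<close> stay below \<open>a / \<theta>\<close> and \<open>b / \<theta>\<close>.
\<close>
lemma fourier_spectrum_pair_ge_pos:
  fixes \<mu> :: "'a::euclidean_space measure" and \<nu> :: "'b::euclidean_space measure"
  assumes \<mu>: "sets \<mu> = sets borel" "finite_measure \<mu>"
    and \<nu>: "sets \<nu> = sets borel" "finite_measure \<nu>" and "0 < \<theta>"
    and x: "x < ennreal (real DIM('a) * \<theta>) + fourier_spectrum \<theta> \<nu>"
      "x < fourier_spectrum \<theta> \<mu> + ennreal (real DIM('b) * \<theta>)"
      "x < fourier_spectrum \<theta> \<mu> + fourier_spectrum \<theta> \<nu>"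
  shows "x \<le> fourier_spectrum \<theta> (\<mu> \<Otimes>\<^sub>M \<nu>)"
proof -
  let ?k = "real DIM('a)" and ?l = "real DIM('b)"
  let ?f = "\<lambda>z. cmod (fourier_transform \<mu> z) powr (2 / \<theta>)"
  let ?g = "\<lambda>z. cmod (fourier_transform \<nu> z) powr (2 / \<theta>)"
  note P = fourier_transform_pair_measure[OF \<mu> \<nu>]
  have "x < \<infinity>" using x(1) by (auto simp: less_top intro: order.strict_trans2)
  then obtain s where s: "x = ennreal s" "0 \<le> s" by (cases x) auto
  show ?thesis
  proof (cases "s = 0")
    case False
    then have "0 < s" using s by simp
    \<comment> \<open>A large or infinite spectrum is replaced by \<open>s + 1\<close>: the three inequalities survive, and
      the rest is arithmetic in the reals.\<close>
    have cap: "\<exists>r\<ge>0. ennreal r \<le> y \<and> (y = ennreal r \<or> r = s + 1)" for y :: ennreal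
    proof (cases "ennreal (s + 1) \<le> y")
      case True
      then show ?thesis using s by (intro exI[of _ "s + 1"]) auto
    next
      case False
      then show ?thesis by (cases y) auto
    qed
    obtain a where a: "0 \<le> a" "ennreal a \<le> fourier_spectrum \<theta> \<mu>"
        "fourier_spectrum \<theta> \<mu> = ennreal a \<or> a = s + 1"
      using cap by blast
    obtain b where b: "0 \<le> b" "ennreal b \<le> fourier_spectrum \<theta> \<nu>"
        "fourier_spectrum \<theta> \<nu> = ennreal b \<or> b = s + 1"
      using cap by blast
    have kl: "0 \<le> ?k * \<theta>" "0 \<le> ?l * \<theta>" using \<open>0 < \<theta>\<close> by auto
    have "s < ?k * \<theta> + b"
      using b(3)
    proof
      assume "fourier_spectrum \<theta> \<nu> = ennreal b"
      then show ?thesis using x(1) s b(1) kl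
        by (simp add: ennreal_less_iff flip: ennreal_plus)
    qed (use kl in linarith)
    moreover have "s < a + ?l * \<theta>"
      using a(3)
    proof
      assume "fourier_spectrum \<theta> \<mu> = ennreal a"
      then show ?thesis using x(2) s a(1) kl
        by (simp add: ennreal_less_iff flip: ennreal_plus)
    qed (use kl in linarith)
    moreover have "s < a + b"
    proof (cases "a = s + 1 \<or> b = s + 1")
      case True then show ?thesis using a(1) b(1) by auto
    next
      case False
      then show ?thesis using a b x(3) s
        by (simp add: ennreal_less_iff flip: ennreal_plus)
    qed
    ultimately have t: "s / \<theta> < ?k + b / \<theta>" "s / \<theta> < a / \<theta> + ?l" "s / \<theta> < a / \<theta> + b / \<theta>"
      using \<open>0 < \<theta>\<close> by (simp_all add: field_simps)
    note f_tail = tail_integral_finite_below_fourier_spectrum[OF \<mu> \<open>0 < \<theta>\<close> a(1,2)]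
    note g_tail = tail_integral_finite_below_fourier_spectrum[OF \<nu> \<open>0 < \<theta>\<close> b(1,2)]
    have "tail_integral (\<lambda>z. ?f (fst z) * ?g (snd z)) (s / \<theta>) < \<infinity>"
    proof (rule tail_integral_product_finite)
      show "tail_integral ?f (s / \<theta> - ?l) < \<infinity>"
        by (rule f_tail) (use t in linarith)
      show "tail_integral ?g (s / \<theta> - ?k) < \<infinity>"
        by (rule g_tail) (use t in linarith)
      assume "s / \<theta> < ?k + ?l"
      then have "max (s / \<theta> - ?l) (s / \<theta> - b / \<theta>) < min ?k (a / \<theta>)"
        using t by (simp add: algebra_simps)
      then obtain u where u: "max (s / \<theta> - ?l) (s / \<theta> - b / \<theta>) < u" "u < min ?k (a / \<theta>)"
        using dense by blast
      then show "\<exists>u\<le>?k. \<exists>v\<le>?l. u + v = s / \<theta> \<and> tail_integral ?f u < \<infinity> \<and> tail_integral ?g v < \<infinity>"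
        by (intro exI[of _ u] conjI exI[of _ "s / \<theta> - u"] f_tail g_tail) auto
    qed (use fourier_transform_power[OF \<mu>, of "2 / \<theta>"] fourier_transform_power[OF \<nu>, of "2 / \<theta>"]
           \<open>0 < \<theta>\<close> in auto)
    then have "energy s \<theta> (\<mu> \<Otimes>\<^sub>M \<nu>) < \<infinity>"
      unfolding energy_finite_iff_tail_integral[OF P(1,2) \<open>0 < \<theta>\<close> \<open>0 < s\<close>]
        fourier_transform_pair_measure_power[OF \<mu> \<nu>] .
    then show ?thesis using s ennreal_le_fourier_spectrum by blast
  qed (use s in simp)
qed

lemma energy_0_finite_iff:
  "energy s 0 m < \<infinity> \<longleftrightarrow> (\<exists>C. \<forall>z. (cmod (fourier_transform m z))\<^sup>2 * norm z powr s \<le> C)"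
proof
  assume fin: "energy s 0 m < \<infinity>"
  have "(cmod (fourier_transform m z))\<^sup>2 * norm z powr s \<le> enn2real (energy s 0 m)" for z
  proof -
    have "ennreal ((cmod (fourier_transform m z))\<^sup>2 * norm z powr s) \<le> energy s 0 m"
      unfolding energy_def by (auto intro: SUP_upper)
    then have "enn2real (ennreal ((cmod (fourier_transform m z))\<^sup>2 * norm z powr s))
        \<le> enn2real (energy s 0 m)"
      using fin by (intro enn2real_mono) auto
    then show ?thesis by simp
  qed
  then show "\<exists>C. \<forall>z. (cmod (fourier_transform m z))\<^sup>2 * norm z powr s \<le> C" by blast
next
  assume "\<exists>C. \<forall>z. (cmod (fourier_transform m z))\<^sup>2 * norm z powr s \<le> C"
  then obtain C where C: "(cmod (fourier_transform m z))\<^sup>2 * norm z powr s \<le> C" for z by blast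
  have "energy s 0 m \<le> ennreal C"
    unfolding energy_def using C by (auto intro!: SUP_least ennreal_leI)
  then show "energy s 0 m < \<infinity>" by (rule le_less_trans) simp
qed

text \<open>
  Lowering the exponent helps where \<open>|z| > 1\<close>; on the unit ball the transform is bounded.
\<close>
lemma energy_0_finite_below_fourier_spectrum:
  fixes m :: "'a::euclidean_space measure"
  assumes m: "sets m = sets borel" "finite_measure m"
    and s: "0 \<le> s" "ennreal s < fourier_spectrum 0 m"
  obtains C where "\<And>z. (cmod (fourier_transform m z))\<^sup>2 * norm z powr s \<le> C"
proof -
  obtain s' where s': "s < s'" "energy s' 0 m < \<infinity>"
    using s less_fourier_spectrumE by blast
  then obtain C where C: "(cmod (fourier_transform m z))\<^sup>2 * norm z powr s' \<le> C" for z
    unfolding energy_0_finite_iff by blast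
  have "(cmod (fourier_transform m z))\<^sup>2 * norm z powr s \<le> max ((measure m UNIV)\<^sup>2) C" for z
  proof (cases "norm z \<le> 1")
    case True
    have "(cmod (fourier_transform m z))\<^sup>2 * norm z powr s \<le> (measure m UNIV)\<^sup>2 * 1"
      using True s cmod_fourier_transform_le[OF m, of z]
      by (intro mult_mono power_mono powr_le1) auto
    then show ?thesis by simp
  next
    case False
    have "(cmod (fourier_transform m z))\<^sup>2 * norm z powr s
        \<le> (cmod (fourier_transform m z))\<^sup>2 * norm z powr s'"
      using False s' by (intro mult_left_mono powr_mono) auto
    then show ?thesis using C[of z] by linarith
  qed
  then show thesis by (rule that)
qed

text \<open>
  The power of \<open>|(x, y)|\<close> is charged to the larger of \<open>|x|\<close> and \<open>|y|\<close>, while the transform in the other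
  variable is merely bounded; hence the minimum of the two spectra and not their sum.
\<close>
lemma fourier_spectrum_0_pair_ge:
  fixes \<mu> :: "'a::euclidean_space measure" and \<nu> :: "'b::euclidean_space measure"
  assumes \<mu>: "sets \<mu> = sets borel" "finite_measure \<mu>"
    and \<nu>: "sets \<nu> = sets borel" "finite_measure \<nu>"
    and x: "x < fourier_spectrum 0 \<mu>" "x < fourier_spectrum 0 \<nu>"
  shows "x \<le> fourier_spectrum 0 (\<mu> \<Otimes>\<^sub>M \<nu>)"
proof -
  have "x < \<infinity>" using x(1) by (auto simp: less_top intro: order.strict_trans2)
  then obtain s where s: "x = ennreal s" "0 \<le> s" by (cases x) auto
  let ?f = "\<lambda>z. (cmod (fourier_transform \<mu> z))\<^sup>2" and ?g = "\<lambda>z. (cmod (fourier_transform \<nu> z))\<^sup>2"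
  obtain C where C: "\<And>z. ?f z * norm z powr s \<le> C"
    using energy_0_finite_below_fourier_spectrum[OF \<mu> s(2)] x s by blast
  obtain D where D: "\<And>z. ?g z * norm z powr s \<le> D"
    using energy_0_finite_below_fourier_spectrum[OF \<nu> s(2)] x s by blast
  define M where "M = (measure \<mu> UNIV)\<^sup>2"
  define N where "N = (measure \<nu> UNIV)\<^sup>2"
  have M: "?f z \<le> M" "0 \<le> M" for z
    unfolding M_def using cmod_fourier_transform_le[OF \<mu>] by (auto intro: power_mono)
  have N: "?g z \<le> N" "0 \<le> N" for z
    unfolding N_def using cmod_fourier_transform_le[OF \<nu>] by (auto intro: power_mono)
  have CD: "0 \<le> C" "0 \<le> D" using C[of 0] D[of 0] by (auto simp: not_less)
  define c where "c = 2 powr \<bar>s\<bar>"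
  have c: "0 \<le> c" by (simp add: c_def)
  have bound: "?f x * ?g y * norm (x, y) powr s \<le> c * (N * C) + c * (M * D)" for x y
  proof -
    consider "x = 0" "y = 0" | "norm x \<le> norm y" "y \<noteq> 0" | "norm y \<le> norm x" "x \<noteq> 0"
      by (metis linear norm_le_zero_iff norm_zero)
    then show ?thesis
    proof cases
      case 1
      then show ?thesis using c CD M N by (simp add: zero_prod_def[symmetric])
    next
      case 2
      have "?f x * ?g y * norm (x, y) powr s \<le> ?f x * ?g y * (c * norm y powr s)"
        unfolding c_def using 2 by (intro mult_left_mono norm_Pair_powr_comparable(1)) auto
      also have "\<dots> = c * (?f x * (?g y * norm y powr s))" by simp
      also have "\<dots> \<le> c * (M * D)"
        using c CD M D by (intro mult_left_mono mult_mono) auto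
      also have "\<dots> \<le> c * (N * C) + c * (M * D)" using c CD N by simp
      finally show ?thesis .
    next
      case 3
      have "?f x * ?g y * norm (x, y) powr s \<le> ?f x * ?g y * (c * norm x powr s)"
        unfolding c_def norm_Pair_commute[of x y]
        using 3 by (intro mult_left_mono norm_Pair_powr_comparable(1)) auto
      also have "\<dots> = c * (?g y * (?f x * norm x powr s))" by simp
      also have "\<dots> \<le> c * (N * C)"
        using c CD N C by (intro mult_left_mono mult_mono) auto
      also have "\<dots> \<le> c * (N * C) + c * (M * D)" using c CD M by simp
      finally show ?thesis .
    qed
  qed
  have "energy s 0 (\<mu> \<Otimes>\<^sub>M \<nu>) < \<infinity>"
    unfolding energy_0_finite_iff
    using bound by (auto simp: fourier_transform_pair_measure(3)[OF \<mu> \<nu>] norm_mult power_mult_distrib)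
  then show ?thesis using s ennreal_le_fourier_spectrum by blast
qed

lemma fourier_spectrum_pair_ge:
  fixes \<mu> :: "'a::euclidean_space measure" and \<nu> :: "'b::euclidean_space measure"
  assumes "sets \<mu> = sets borel" "finite_measure \<mu>" "sets \<nu> = sets borel" "finite_measure \<nu>" "0 \<le> \<theta>"
  shows "Min {ennreal (real DIM('a) * \<theta>) + fourier_spectrum \<theta> \<nu>,
           fourier_spectrum \<theta> \<mu> + ennreal (real DIM('b) * \<theta>),
           fourier_spectrum \<theta> \<mu> + fourier_spectrum \<theta> \<nu>} \<le> fourier_spectrum \<theta> (\<mu> \<Otimes>\<^sub>M \<nu>)"
proof (rule dense_le)
  fix x
  assume "x < Min {ennreal (real DIM('a) * \<theta>) + fourier_spectrum \<theta> \<nu>,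
           fourier_spectrum \<theta> \<mu> + ennreal (real DIM('b) * \<theta>),
           fourier_spectrum \<theta> \<mu> + fourier_spectrum \<theta> \<nu>}"
  then have x: "x < ennreal (real DIM('a) * \<theta>) + fourier_spectrum \<theta> \<nu>"
      "x < fourier_spectrum \<theta> \<mu> + ennreal (real DIM('b) * \<theta>)"
      "x < fourier_spectrum \<theta> \<mu> + fourier_spectrum \<theta> \<nu>" by simp_all
  show "x \<le> fourier_spectrum \<theta> (\<mu> \<Otimes>\<^sub>M \<nu>)"
  proof (cases "\<theta> = 0")
    case True
    then show ?thesis using x fourier_spectrum_0_pair_ge[OF assms(1-4)] by simp
  next
    case False
    then show ?thesis using x assms by (intro fourier_spectrum_pair_ge_pos) auto
  qed
qed

section \<open>Upper bound for the spectrum of a product\<close>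

text \<open>
  Each order \<open>s > k * \<theta>\<close> with finite energy for the product yields the order \<open>s - k * \<theta>\<close> for \<open>\<nu>\<close>, by
  looking only at small \<open>x\<close>, or at \<open>x = 0\<close> if \<open>\<theta> = 0\<close>.
\<close>
lemma fourier_spectrum_pair_le:
  fixes \<mu> :: "'a::euclidean_space measure" and \<nu> :: "'b::euclidean_space measure"
  assumes \<mu>: "nonzero_finite_borel_measure \<mu>"
    and \<nu>: "sets \<nu> = sets borel" "finite_measure \<nu>" and "0 \<le> \<theta>"
  shows "fourier_spectrum \<theta> (\<mu> \<Otimes>\<^sub>M \<nu>) \<le> ennreal (real DIM('a) * \<theta>) + fourier_spectrum \<theta> \<nu>"
  unfolding fourier_spectrum_def[of _ "\<mu> \<Otimes>\<^sub>M \<nu>"]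
proof (rule Sup_least, clarify)
  fix s :: real
  assume "0 \<le> s" and fin: "energy s \<theta> (\<mu> \<Otimes>\<^sub>M \<nu>) < \<infinity>"
  have \<mu>': "sets \<mu> = sets borel" "finite_measure \<mu>" "emeasure \<mu> UNIV \<noteq> 0"
    using \<mu> by (auto simp: nonzero_finite_borel_measure_def)
  note P = fourier_transform_pair_measure[OF \<mu>'(1,2) \<nu>]
  let ?k = "real DIM('a)"
  show "ennreal s \<le> ennreal (?k * \<theta>) + fourier_spectrum \<theta> \<nu>"
  proof (cases "s \<le> ?k * \<theta>")
    case True
    then show ?thesis by (simp add: add_increasing2 ennreal_leI)
  next
    case False
    have "energy (s - ?k * \<theta>) \<theta> \<nu> < \<infinity>"
    proof (cases "\<theta> = 0")
      case True
      obtain C where C: "(cmod (fourier_transform (\<mu> \<Otimes>\<^sub>M \<nu>) z))\<^sup>2 * norm z powr s \<le> C" for z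
        using fin unfolding True energy_0_finite_iff by blast
      interpret finite_measure \<mu> by fact
      let ?M = "(measure \<mu> UNIV)\<^sup>2"
      have "0 < ?M" using \<mu>'(3) by (simp add: emeasure_eq_measure)
      have "(cmod (fourier_transform \<nu> y))\<^sup>2 * norm y powr s \<le> C / ?M" for y
        using C[of "(0, y)"] \<open>0 < ?M\<close>
        by (simp add: P(3) fourier_transform_0[OF \<mu>'(1)] norm_mult power_mult_distrib field_simps)
      then have "energy s 0 \<nu> < \<infinity>"
        unfolding energy_0_finite_iff by blast
      then show ?thesis using True by simp
    next
      case nz: False
      then have "0 < \<theta>" using \<open>0 \<le> \<theta>\<close> by simp
      let ?f = "\<lambda>z. cmod (fourier_transform \<mu> z) powr (2 / \<theta>)"
      let ?g = "\<lambda>z. cmod (fourier_transform \<nu> z) powr (2 / \<theta>)"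
      have "0 \<le> ?k * \<theta>" using \<open>0 < \<theta>\<close> by simp
      then have s: "0 < s" "0 < s - ?k * \<theta>"
        using False by linarith+
      have quot: "(s - ?k * \<theta>) / \<theta> = s / \<theta> - ?k"
        using \<open>0 < \<theta>\<close> by (simp add: field_simps)
      have prod_fin: "tail_integral (\<lambda>z. ?f (fst z) * ?g (snd z)) (s / \<theta>) < \<infinity>"
        using fin unfolding energy_finite_iff_tail_integral[OF P(1,2) \<open>0 < \<theta>\<close> s(1)]
          fourier_transform_pair_measure_power[OF \<mu>'(1,2) \<nu>] .
      obtain \<delta> a where "0 < \<delta>" "0 < a" "\<And>z. norm z \<le> \<delta> \<Longrightarrow> a \<le> ?f z"
        using fourier_transform_power_lower_bound[OF \<mu>, of "2 / \<theta>"] \<open>0 < \<theta>\<close> by auto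
      then have "tail_integral ?g (s / \<theta> - ?k) < \<infinity>"
        using prod_fin fourier_transform_power(1)[OF \<mu>'(1,2), of "2 / \<theta>"]
          fourier_transform_power(1)[OF \<nu>, of "2 / \<theta>"] \<open>0 < \<theta>\<close>
        by (intro tail_integral_factor_finite[of ?f ?g \<delta> a]) auto
      then show ?thesis
        unfolding energy_finite_iff_tail_integral[OF \<nu> \<open>0 < \<theta>\<close> s(2)] quot .
    qed
    then have "ennreal (s - ?k * \<theta>) \<le> fourier_spectrum \<theta> \<nu>"
      using False by (intro ennreal_le_fourier_spectrum) auto
    then have "ennreal (?k * \<theta>) + ennreal (s - ?k * \<theta>) \<le> ennreal (?k * \<theta>) + fourier_spectrum \<theta> \<nu>"
      by (rule add_left_mono)
    moreover have "ennreal (?k * \<theta>) + ennreal (s - ?k * \<theta>) = ennreal s"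
      using False \<open>0 \<le> \<theta>\<close> by (subst ennreal_plus[symmetric]) auto
    ultimately show ?thesis by simp
  qed
qed

text \<open>
  The coordinate swap preserves the norm and Lebesgue measure and exchanges the factors of the
  transform, so all energies agree.
\<close>
lemma fourier_spectrum_pair_commute:
  fixes \<mu> :: "'a::euclidean_space measure" and \<nu> :: "'b::euclidean_space measure"
  assumes \<mu>: "sets \<mu> = sets borel" "finite_measure \<mu>"
    and \<nu>: "sets \<nu> = sets borel" "finite_measure \<nu>"
  shows "fourier_spectrum \<theta> (\<mu> \<Otimes>\<^sub>M \<nu>) = fourier_spectrum \<theta> (\<nu> \<Otimes>\<^sub>M \<mu>)"
proof -
  note P = fourier_transform_pair_measure[OF \<mu> \<nu>] and Q = fourier_transform_pair_measure[OF \<nu> \<mu>]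
  have swap: "fourier_transform (\<mu> \<Otimes>\<^sub>M \<nu>) (x, y) = fourier_transform (\<nu> \<Otimes>\<^sub>M \<mu>) (y, x)" for x y
    by (simp add: P(3) Q(3))
  have "energy s \<theta> (\<mu> \<Otimes>\<^sub>M \<nu>) = energy s \<theta> (\<nu> \<Otimes>\<^sub>M \<mu>)" for s
  proof (cases "\<theta> = 0")
    case True
    define h where "h = (\<lambda>z. ennreal ((cmod (fourier_transform (\<nu> \<Otimes>\<^sub>M \<mu>) z))\<^sup>2 * norm z powr s))"
    have "(SUP z. ennreal ((cmod (fourier_transform (\<mu> \<Otimes>\<^sub>M \<nu>) z))\<^sup>2 * norm z powr s))
        = (SUP z. h (prod.swap z))"
    proof (rule SUP_cong)
      fix z :: "'a \<times> 'b"
      show "ennreal ((cmod (fourier_transform (\<mu> \<Otimes>\<^sub>M \<nu>) z))\<^sup>2 * norm z powr s) = h (prod.swap z)"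
        by (cases z) (simp only: h_def swap swap_simp,
            simp add: norm_Pair add.commute)
    qed simp
    also have "\<dots> = (SUP z. h z)"
      unfolding image_image[of h prod.swap UNIV, symmetric] surj_swap ..
    finally show ?thesis
      using True by (simp add: energy_def h_def)
  next
    case False
    define w where "w = s / \<theta> - real DIM('a \<times> 'b)"
    have w: "w = s / \<theta> - real DIM('b \<times> 'a)" by (simp add: w_def)
    define F where "F = (\<lambda>z. ennreal (cmod (fourier_transform (\<mu> \<Otimes>\<^sub>M \<nu>) z) powr (2 / \<theta>) * norm z powr w))"
    define G where "G = (\<lambda>z. ennreal (cmod (fourier_transform (\<nu> \<Otimes>\<^sub>M \<mu>) z) powr (2 / \<theta>) * norm z powr w))"
    have [measurable]: "fourier_transform (\<mu> \<Otimes>\<^sub>M \<nu>) \<in> borel_measurable borel"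
        "fourier_transform (\<nu> \<Otimes>\<^sub>M \<mu>) \<in> borel_measurable borel"
      using continuous_on_fourier_transform[OF P(1,2)] continuous_on_fourier_transform[OF Q(1,2)]
      by (simp_all add: borel_measurable_continuous_onI)
    have FG [measurable]: "F \<in> borel_measurable borel" "G \<in> borel_measurable borel"
      unfolding F_def G_def by measurable
    have FG_swap: "F (x, y) = G (y, x)" for x y
      unfolding F_def G_def swap norm_Pair_commute[of x y] ..
    have "(\<integral>\<^sup>+ z. F z \<partial>lborel) = (\<integral>\<^sup>+ x. \<integral>\<^sup>+ y. F (x, y) \<partial>lborel \<partial>lborel)"
      by (rule nn_integral_lborel_Pair(1)) (rule FG)
    also have "\<dots> = (\<integral>\<^sup>+ x. \<integral>\<^sup>+ y. G (y, x) \<partial>lborel \<partial>lborel)"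
      by (simp only: FG_swap)
    also have "\<dots> = (\<integral>\<^sup>+ z. G z \<partial>lborel)"
      by (rule nn_integral_lborel_Pair(2)[symmetric]) (rule FG)
    finally show ?thesis
      using False unfolding energy_def F_def G_def by (simp only: w_def[symmetric] w[symmetric] if_False)
  qed
  then show ?thesis by (simp add: fourier_spectrum_def)
qed

section \<open>Fourier spectrum and Fourier dimension of a product measure\<close>

theorem theorem2p1:
  fixes \<mu> :: "(real ^ 'k) measure" and \<nu> :: "(real ^ 'l) measure"
  assumes "nonzero_finite_borel_measure \<mu>"
    and "nonzero_finite_borel_measure \<nu>"
  shows "(\<forall>\<theta>\<in>{0..1}.
            fourier_spectrum \<theta> (\<mu> \<Otimes>\<^sub>M \<nu>)
              \<ge> Min {ennreal (real CARD('k) * \<theta>) + fourier_spectrum \<theta> \<nu>,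
                     fourier_spectrum \<theta> \<mu> + ennreal (real CARD('l) * \<theta>),
                     fourier_spectrum \<theta> \<mu> + fourier_spectrum \<theta> \<nu>})
       \<and> (\<forall>\<theta>\<in>{0..1}.
            fourier_spectrum \<theta> (\<mu> \<Otimes>\<^sub>M \<nu>)
              \<le> Min {ennreal (real CARD('k) * \<theta>) + fourier_spectrum \<theta> \<nu>,
                     fourier_spectrum \<theta> \<mu> + ennreal (real CARD('l) * \<theta>)})
       \<and> fourier_dim (\<mu> \<Otimes>\<^sub>M \<nu>) = Min {fourier_dim \<mu>, fourier_dim \<nu>}"
proof -
  have \<mu>: "sets \<mu> = sets borel" "finite_measure \<mu>" and \<nu>: "sets \<nu> = sets borel" "finite_measure \<nu>"
    using assms by (auto simp: nonzero_finite_borel_measure_def)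
  have lower: "Min {ennreal (real CARD('k) * \<theta>) + fourier_spectrum \<theta> \<nu>,
        fourier_spectrum \<theta> \<mu> + ennreal (real CARD('l) * \<theta>),
        fourier_spectrum \<theta> \<mu> + fourier_spectrum \<theta> \<nu>} \<le> fourier_spectrum \<theta> (\<mu> \<Otimes>\<^sub>M \<nu>)"
    if "0 \<le> \<theta>" for \<theta>
    using fourier_spectrum_pair_ge[OF \<mu> \<nu> that] by (simp only: DIM_cart DIM_real mult_1_right)
  have upper: "fourier_spectrum \<theta> (\<mu> \<Otimes>\<^sub>M \<nu>)
      \<le> Min {ennreal (real CARD('k) * \<theta>) + fourier_spectrum \<theta> \<nu>,
             fourier_spectrum \<theta> \<mu> + ennreal (real CARD('l) * \<theta>)}" if "0 \<le> \<theta>" for \<theta>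
    using fourier_spectrum_pair_le[OF assms(1) \<nu> that] fourier_spectrum_pair_le[OF assms(2) \<mu> that]
      fourier_spectrum_pair_commute[OF \<mu> \<nu>, of \<theta>]
    by (simp add: add.commute)
  have "fourier_dim (\<mu> \<Otimes>\<^sub>M \<nu>) = Min {fourier_dim \<mu>, fourier_dim \<nu>}"
  proof (rule antisym)
    show "fourier_dim (\<mu> \<Otimes>\<^sub>M \<nu>) \<le> Min {fourier_dim \<mu>, fourier_dim \<nu>}"
      using upper[of 0] by (simp add: fourier_dim_eq_fourier_spectrum_0)
    have "Min {fourier_dim \<mu>, fourier_dim \<nu>}
        \<le> Min {fourier_dim \<nu>, fourier_dim \<mu>, fourier_dim \<mu> + fourier_dim \<nu>}"
      by (auto simp: min_le_iff_disj intro: add_increasing2)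
    then show "Min {fourier_dim \<mu>, fourier_dim \<nu>} \<le> fourier_dim (\<mu> \<Otimes>\<^sub>M \<nu>)"
      using lower[of 0] unfolding fourier_dim_eq_fourier_spectrum_0
      by (simp add: min.commute)
  qed
  then show ?thesis using lower upper by auto
qed

end
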